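(* Let $F$ and $G$ be two continuous distribution functions on $\mathbb{R}$ such that $F(0)=G(0)=0$, both strictly increasing on $[0,\infty)$. Let $t>0$ and assume that the left derivative $F^\prime(t-)$ of $F$ at $t$ and the right derivative $G^\prime(t+)$ of $G$ at $t$ exist and satisfy $F^\prime(t-)>0$ and $G^\prime(t+)>0$. Let $\beta\in(0,1)$ and let $\{Z_n:n\geq 1\}$ be random variables on a probability space $(\Omega,\mathcal{F},P)$ with distribution functions $$P(Z_n\leq x)=\begin{cases}\beta\left(\frac{F(x)}{F(t)}\right)^n&\text{if }x\in[0,t]\\ 1-(1-\beta)\left(\frac{1-G(x)}{1-G(t)}\right)^n&\text{if }x\in(t,\infty).\end{cases}$$ Then, for every family of positive numbers $\{a_n:n\geq 1\}$ such that $a_n\log n\to 0$ and $a_nn\to\infty$ as $n\to\infty$, the sequence of random variables $\{a_nn(Z_n-t):n\geq 1\}$ satisfies the large deviation principle with speed $1/a_n$ and rate function $I_{\mathrm{MD}}:\mathbb{R}\to[0,\infty]$ defined by $$I_{\mathrm{MD}}(x):=\begin{cases}-\frac{F^\prime(t-)}{F(t)}\,x&\text{if }x\leq 0\\ \frac{G^\prime(t+)}{1-G(t)}\,x&\text{if }x>0.\end{cases}$$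
   Context: Large deviation principle (LDP): a speed is a sequence $\{v_n\}$ with $v_n\to\infty$; a rate function on $\mathbb{R}$ is a lower semicontinuous function $I:\mathbb{R}\to[0,\infty]$ (its level sets are not required to be compact in the definition). A sequence $\{Y_n\}$ of real random variables satisfies the LDP with speed $v_n$ and rate function $I$ if $$\limsup_{n\to\infty}\frac{1}{v_n}\log P(Y_n\in C)\leq-\inf_{x\in C}I(x)\quad\text{for all closed sets }C\subset\mathbb{R},$$ $$\liminf_{n\to\infty}\frac{1}{v_n}\log P(Y_n\in O)\geq-\inf_{x\in O}I(x)\quad\text{for all open sets }O\subset\mathbb{R},$$ with the conventions $\log 0=-\infty$ and $\inf\emptyset=\infty$. The one-sided derivatives are finite real numbers. Since $P(Z_n\leq 0)=0$, one has $P(Z_n\leq x)=0$ for $x<0$. *)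

theory Defs
  imports "HOL-Probability.Probability"
begin

definition distribution_function :: "(real \<Rightarrow> real) \<Rightarrow> bool" where
  "distribution_function F \<longleftrightarrow> (\<exists>\<mu>. real_distribution \<mu> \<and> F = cdf \<mu>)"

text \<open>Logarithm of a probability with the convention \<open>log 0 = -\<infinity>\<close>; the library function has
  \<open>ln 0 = 0\<close>.\<close>

definition log_prob :: "real \<Rightarrow> ereal" where
  "log_prob p = (if p = 0 then -\<infinity> else ereal (ln p))"

definition lower_semicontinuous :: "('a::topological_space \<Rightarrow> ereal) \<Rightarrow> bool" where
  "lower_semicontinuous f \<longleftrightarrow> (\<forall>x. \<forall>c<f x. \<forall>\<^sub>F y in nhds x. c < f y)"

definition rate_function :: "(real \<Rightarrow> ereal) \<Rightarrow> bool" where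
  "rate_function I \<longleftrightarrow> (\<forall>x. 0 \<le> I x) \<and> lower_semicontinuous I"

text \<open>Sequences are indexed by \<open>n \<ge> 1\<close>; the values at \<open>n = 0\<close> are irrelevant. In \<^typ>\<open>ereal\<close> the
  infimum over the empty set is \<open>\<infinity>\<close>.\<close>

definition satisfies_LDP ::
  "'a measure \<Rightarrow> (nat \<Rightarrow> 'a \<Rightarrow> real) \<Rightarrow> (nat \<Rightarrow> real) \<Rightarrow> (real \<Rightarrow> ereal) \<Rightarrow> bool" where
  "satisfies_LDP M Y v I \<longleftrightarrow>
     (\<forall>n\<ge>1. Y n \<in> borel_measurable M) \<and>
     filterlim v at_top sequentially \<and>
     rate_function I \<and>
     (\<forall>C. closed C \<longrightarrow>
        limsup (\<lambda>n. ereal (1 / v n) * log_prob \<P>(\<omega> in M. Y n \<omega> \<in> C)) \<le> - (INF x\<in>C. I x)) \<and>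
     (\<forall>U. open U \<longrightarrow>
        - (INF x\<in>U. I x) \<le> liminf (\<lambda>n. ereal (1 / v n) * log_prob \<P>(\<omega> in M. Y n \<omega> \<in> U)))"

end

theory Submission
  imports Defs
begin

text \<open>Both tails of \<open>Y n = a n * n * (Z n - t)\<close> are explicit \<open>n\<close>-th powers, and the one-sided derivatives
  at \<open>t\<close> give \<open>a n * ln P(Y n \<le> -x) \<rightarrow> - p * x\<close> and \<open>a n * ln P(Y n > x) \<rightarrow> - q * x\<close> for \<open>x \<ge> 0\<close>,
  where \<open>p = F't / F t\<close> and \<open>q = G't / (1 - G t)\<close>. These
  tail limits already imply the LDP: a set on which the rate exceeds \<open>c\<close> is covered by the two tails
  beyond \<open>-c / p\<close> and \<open>c / q\<close>, while the half-open interval between two nearby points on one side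
  of the origin has the same exponential decay as the larger of its two tails.\<close>

section \<open>One-sided derivatives and logarithms of \<open>n\<close>-th powers\<close>

text \<open>For nonzero \<open>x\<close> the sequence is the difference quotient along the points
  \<open>t + x / r n\<close>, multiplied by \<open>x\<close>. Allowing \<open>insert t S\<close>
  lets the lemma cover \<open>x = 0\<close>, where the increment vanishes, even when
  \<open>S\<close> is an open half-neighbourhood missing \<open>t\<close>.\<close>

lemma rescaled_increment_tendsto:
  fixes g :: "real \<Rightarrow> real"
  assumes deriv: "(g has_real_derivative D) (at t within S)"
    and r: "filterlim r at_top sequentially"
    and S: "\<forall>\<^sub>F n in sequentially. t + x / r n \<in> insert t S"
  shows "(\<lambda>n. r n * (g (t + x / r n) - g t)) \<longlonglongrightarrow> D * x"
proof (cases "x = 0")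
  case False
  have r0: "\<forall>\<^sub>F n in sequentially. r n > 0"
    using r by (simp add: filterlim_at_top_dense)
  have "(\<lambda>n. x / r n) \<longlonglongrightarrow> 0"
    using r by (intro real_tendsto_divide_at_top[OF tendsto_const])
  then have "(\<lambda>n. t + x / r n) \<longlonglongrightarrow> t + 0"
    by (intro tendsto_add tendsto_const)
  \<comment> \<open>The filter \<open>at t within S\<close> is punctured, so the points must avoid
    \<open>t\<close>; this holds because \<open>x\<close> is nonzero.\<close>
  moreover have "\<forall>\<^sub>F n in sequentially. t + x / r n \<in> S \<and> t + x / r n \<noteq> t"
    using S r0 by eventually_elim (use False in auto)
  ultimately have lim: "filterlim (\<lambda>n. t + x / r n) (at t within S) sequentially"
    by (simp add: filterlim_at)
  have "((\<lambda>y. (g y - g t) / (y - t)) \<longlongrightarrow> D) (at t within S)"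
    using deriv by (simp add: has_field_derivative_iff)
  then have "(\<lambda>n. (g (t + x / r n) - g t) / (t + x / r n - t)) \<longlonglongrightarrow> D"
    using lim by (rule filterlim_compose)
  then have "(\<lambda>n. (g (t + x / r n) - g t) / (t + x / r n - t) * x) \<longlonglongrightarrow> D * x"
    by (intro tendsto_mult tendsto_const)
  moreover have "\<forall>\<^sub>F n in sequentially.
      (g (t + x / r n) - g t) / (t + x / r n - t) * x = r n * (g (t + x / r n) - g t)"
    using r0 by eventually_elim (use False in \<open>simp add: field_simps\<close>)
  ultimately show ?thesis
    by (rule Lim_transform_eventually)
qed simp

text \<open>The logarithm turns the power into a factor \<open>n\<close>: the sequence is
  \<open>a n * ln c\<close>, which vanishes, plus \<open>a n * n\<close> times an increment of
  \<open>ln (f y)\<close>, whose derivative at \<open>t\<close> is \<open>D / f t\<close>. Both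
  tails are instances, with \<open>f = F\<close> on the left of \<open>t\<close> and
  \<open>f = 1 - G\<close> on the right.\<close>

lemma scaled_ln_power_tendsto:
  fixes f :: "real \<Rightarrow> real" and a :: "nat \<Rightarrow> real"
  assumes deriv: "(f has_real_derivative D) (at t within S)"
    and pos: "\<forall>y\<in>insert t S. f y > 0"
    and c: "c > 0"
    and a: "a \<longlonglongrightarrow> 0"
    and an: "filterlim (\<lambda>n. a n * real n) at_top sequentially"
    and S: "\<forall>\<^sub>F n in sequentially. t + x / (a n * real n) \<in> insert t S"
  shows "\<forall>\<^sub>F n in sequentially. c * (f (t + x / (a n * real n)) / f t) ^ n > 0"
    and "(\<lambda>n. a n * ln (c * (f (t + x / (a n * real n)) / f t) ^ n)) \<longlonglongrightarrow> D / f t * x"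
proof -
  have ev: "\<forall>\<^sub>F n in sequentially. f (t + x / (a n * real n)) > 0"
    using S by eventually_elim (use pos in blast)
  then show "\<forall>\<^sub>F n in sequentially. c * (f (t + x / (a n * real n)) / f t) ^ n > 0"
    by eventually_elim (use c pos in simp)
  have "((\<lambda>y. ln (f y)) has_real_derivative D / f t) (at t within S)"
    using deriv pos by (auto intro!: derivative_eq_intros)
  from rescaled_increment_tendsto[OF this an S]
  have "(\<lambda>n. a n * real n * (ln (f (t + x / (a n * real n))) - ln (f t))) \<longlonglongrightarrow> D / f t * x" .
  moreover have "(\<lambda>n. a n * ln c) \<longlonglongrightarrow> 0"
    using tendsto_mult_left_zero[OF a] by simp
  ultimately have "(\<lambda>n. a n * ln c + a n * real n * (ln (f (t + x / (a n * real n))) - ln (f t)))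
      \<longlonglongrightarrow> D / f t * x"
    using tendsto_add by fastforce
  moreover have "\<forall>\<^sub>F n in sequentially.
      a n * ln c + a n * real n * (ln (f (t + x / (a n * real n))) - ln (f t))
      = a n * ln (c * (f (t + x / (a n * real n)) / f t) ^ n)"
    using ev
  proof eventually_elim
    case (elim n)
    have "ln (c * (f (t + x / (a n * real n)) / f t) ^ n)
        = ln c + real n * (ln (f (t + x / (a n * real n))) - ln (f t))"
      using elim c pos by (simp add: ln_mult ln_realpow ln_div)
    then show ?case by (simp only: distrib_left mult.assoc)
  qed
  ultimately show "(\<lambda>n. a n * ln (c * (f (t + x / (a n * real n)) / f t) ^ n)) \<longlonglongrightarrow> D / f t * x"
    by (rule Lim_transform_eventually)
qed

section \<open>Exponential rates of differences and sums\<close>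

text \<open>Since \<open>s' < s\<close>, the term \<open>B n\<close> is exponentially smaller than
  \<open>A n\<close>, so the difference eventually retains half of \<open>A n\<close>. The factor
  1/2 costs only \<open>a n * ln 2\<close>, which tends to 0.\<close>

lemma liminf_log_prob_ge:
  fixes a P A B :: "nat \<Rightarrow> real"
  assumes apos: "\<forall>\<^sub>F n in sequentially. a n > 0" and a: "a \<longlonglongrightarrow> 0"
    and A: "\<forall>\<^sub>F n in sequentially. A n > 0" "(\<lambda>n. a n * ln (A n)) \<longlonglongrightarrow> s"
    and B: "\<forall>\<^sub>F n in sequentially. B n > 0" "(\<lambda>n. a n * ln (B n)) \<longlonglongrightarrow> s'"
    and "s' < s"
    and P: "\<forall>\<^sub>F n in sequentially. A n - B n \<le> P n"
  shows "ereal s \<le> liminf (\<lambda>n. ereal (a n) * log_prob (P n))"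
proof -
  have ln2: "(\<lambda>n. a n * ln 2) \<longlonglongrightarrow> 0"
    using tendsto_mult_left_zero[OF a] by simp
  \<comment> \<open>Once divided by \<open>a n\<close>, positivity of this sequence says exactly
    that \<open>B n < A n / 2\<close>.\<close>
  have "(\<lambda>n. a n * ln (A n) - a n * ln 2 - a n * ln (B n)) \<longlonglongrightarrow> s - 0 - s'"
    by (intro tendsto_diff A B ln2)
  then have "\<forall>\<^sub>F n in sequentially. a n * ln (A n) - a n * ln 2 - a n * ln (B n) > 0"
    using \<open>s' < s\<close> by (intro order_tendstoD(1)) auto
  then have le: "\<forall>\<^sub>F n in sequentially.
      ereal (a n * ln (A n) - a n * ln 2) \<le> ereal (a n) * log_prob (P n)"
    using apos A(1) B(1) P
  proof eventually_elim
    case (elim n)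
    have "a n * (ln (A n) - ln 2 - ln (B n)) > 0"
      using elim by (simp add: algebra_simps)
    then have "ln (B n) < ln (A n / 2)"
      using elim by (simp add: zero_less_mult_iff ln_div)
    then have "B n < A n / 2"
      using elim by simp
    then have P2: "A n / 2 \<le> P n"
      using elim by simp
    then have "ln (A n / 2) \<le> ln (P n)"
      using elim by (subst ln_le_cancel_iff) auto
    then have "a n * (ln (A n) - ln 2) \<le> a n * ln (P n)"
      using elim by (simp add: ln_div)
    then show ?case
      using P2 elim by (simp add: log_prob_def algebra_simps)
  qed
  have "(\<lambda>n. a n * ln (A n) - a n * ln 2) \<longlonglongrightarrow> s - 0"
    by (intro tendsto_diff A ln2)
  then have "(\<lambda>n. ereal (a n * ln (A n) - a n * ln 2)) \<longlonglongrightarrow> ereal s"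
    by simp
  then have "ereal s = liminf (\<lambda>n. ereal (a n * ln (A n) - a n * ln 2))"
    by (intro lim_imp_Liminf[symmetric]) simp_all
  also have "\<dots> \<le> liminf (\<lambda>n. ereal (a n) * log_prob (P n))"
    using le by (rule Liminf_mono)
  finally show ?thesis .
qed

text \<open>A sum is at most twice its larger term, and the factor 2 disappears after scaling by
  \<open>a n\<close>. Both terms have the same rate, so their maximum has it too.\<close>

lemma limsup_log_prob_le:
  fixes a P A B :: "nat \<Rightarrow> real"
  assumes apos: "\<forall>\<^sub>F n in sequentially. a n > 0" and a: "a \<longlonglongrightarrow> 0"
    and A: "\<forall>\<^sub>F n in sequentially. A n > 0" "(\<lambda>n. a n * ln (A n)) \<longlonglongrightarrow> s"
    and B: "\<forall>\<^sub>F n in sequentially. B n > 0" "(\<lambda>n. a n * ln (B n)) \<longlonglongrightarrow> s"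
    and P: "\<forall>\<^sub>F n in sequentially. 0 \<le> P n \<and> P n \<le> A n + B n"
  shows "limsup (\<lambda>n. ereal (a n) * log_prob (P n)) \<le> ereal s"
proof -
  let ?u = "\<lambda>n. a n * ln 2 + max (a n * ln (A n)) (a n * ln (B n))"
  have le: "\<forall>\<^sub>F n in sequentially. ereal (a n) * log_prob (P n) \<le> ereal (?u n)"
    using apos A(1) B(1) P
  proof eventually_elim
    case (elim n)
    show ?case
    proof (cases "P n = 0")
      \<comment> \<open>Here \<open>log_prob\<close> is minus infinity, and so is its product with
        the positive \<open>a n\<close>.\<close>
      case True
      then show ?thesis using elim by (simp add: log_prob_def)
    next
      case False
      have "P n \<le> 2 * max (A n) (B n)"
        using elim by linarith
      then have "ln (P n) \<le> ln (2 * max (A n) (B n))"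
        using False elim by (subst ln_le_cancel_iff) auto
      also have "\<dots> = ln 2 + max (ln (A n)) (ln (B n))"
        using elim by (auto simp: ln_mult max_def)
      finally have "a n * ln (P n) \<le> a n * (ln 2 + max (ln (A n)) (ln (B n)))"
        using elim by (intro mult_left_mono) auto
      also have "\<dots> = ?u n"
        using elim by (simp add: distrib_left max_mult_distrib_left)
      finally show ?thesis
        using False by (simp add: log_prob_def)
    qed
  qed
  have "(\<lambda>n. a n * ln 2) \<longlonglongrightarrow> 0"
    using tendsto_mult_left_zero[OF a] by simp
  then have "?u \<longlonglongrightarrow> 0 + max s s"
    by (intro tendsto_add tendsto_max A B)
  then have "(\<lambda>n. ereal (?u n)) \<longlonglongrightarrow> ereal s"
    by simp
  then have "limsup (\<lambda>n. ereal (?u n)) = ereal s"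
    by (simp add: lim_imp_Limsup)
  with Limsup_mono[OF le] show ?thesis
    by simp
qed

section \<open>From tail limits to the large deviation principle\<close>

text \<open>With nonnegative slopes the case distinction is a maximum of two linear functions, hence
  continuous across the origin.\<close>

lemma rate_function_two_slopes:
  assumes "p \<ge> 0" "q \<ge> 0"
  shows "rate_function (\<lambda>x. if x \<le> 0 then ereal (- p * x) else ereal (q * x))"
proof -
  let ?f = "\<lambda>x. max (- p * x) (q * x)"
  have eq: "(\<lambda>x. if x \<le> 0 then ereal (- p * x) else ereal (q * x)) = (\<lambda>x. ereal (?f x))"
  proof
    fix x :: real
    have "q * x \<le> - p * x" if "x \<le> 0"
      using assms that by (metis minus_mult_left mult_nonneg_nonpos neg_0_le_iff_le order_trans)
    moreover have "- p * x \<le> q * x" if "x > 0"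
      using assms that by (meson less_imp_le mult_right_mono neg_le_0_iff_le order_trans)
    ultimately show "(if x \<le> 0 then ereal (- p * x) else ereal (q * x)) = ereal (?f x)"
      by (auto simp: max_def)
  qed
  have "continuous_on UNIV (\<lambda>x. ereal (?f x))"
    by (intro continuous_intros)
  then have "((\<lambda>x. ereal (?f x)) \<longlongrightarrow> ereal (?f x)) (nhds x)" for x
    using continuous_on_eq_continuous_at[OF open_UNIV] isCont_def tendsto_at_iff_tendsto_nhds by blast
  then have "lower_semicontinuous (\<lambda>x. ereal (?f x))"
    unfolding lower_semicontinuous_def by (blast dest: order_tendstoD(1))
  moreover have "0 \<le> ?f x" for x
    using assms by (cases "x \<le> 0") (auto simp: le_max_iff_disj mult_nonneg_nonpos)
  ultimately show ?thesis
    unfolding eq rate_function_def zero_ereal_def ereal_less_eq by blast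
qed

text \<open>The tails are closed on the left and open on the right: these are the events that a
  distribution function evaluates directly or by complement, and differences of two tails on one
  side are half-open intervals.\<close>

lemma satisfies_LDP_if_tail_limits:
  fixes Y :: "nat \<Rightarrow> 'a \<Rightarrow> real" and a :: "nat \<Rightarrow> real"
  assumes "prob_space M"
    and meas: "\<And>n. n \<ge> 1 \<Longrightarrow> Y n \<in> borel_measurable M"
    and apos: "\<And>n. n \<ge> 1 \<Longrightarrow> a n > 0" and a: "a \<longlonglongrightarrow> 0"
    and "p > 0" "q > 0"
    and left: "\<And>x. x \<ge> 0 \<Longrightarrow> \<forall>\<^sub>F n in sequentially. \<P>(\<omega> in M. Y n \<omega> \<le> - x) > 0"
      "\<And>x. x \<ge> 0 \<Longrightarrow> (\<lambda>n. a n * ln \<P>(\<omega> in M. Y n \<omega> \<le> - x)) \<longlonglongrightarrow> - p * x"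
    and right: "\<And>x. x \<ge> 0 \<Longrightarrow> \<forall>\<^sub>F n in sequentially. \<P>(\<omega> in M. x < Y n \<omega>) > 0"
      "\<And>x. x \<ge> 0 \<Longrightarrow> (\<lambda>n. a n * ln \<P>(\<omega> in M. x < Y n \<omega>)) \<longlonglongrightarrow> - q * x"
  shows "satisfies_LDP M Y (\<lambda>n. 1 / a n)
      (\<lambda>x. if x \<le> 0 then ereal (- p * x) else ereal (q * x))"
proof -
  interpret prob_space M by fact
  let ?I = "\<lambda>x. if x \<le> 0 then ereal (- p * x) else ereal (q * x)"
  have ge1: "\<forall>\<^sub>F n :: nat in sequentially. n \<ge> 1"
    by (rule eventually_ge_at_top)
  have evpos: "\<forall>\<^sub>F n in sequentially. a n > 0"
    using ge1 by eventually_elim (rule apos)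
  have "filterlim a (at_right 0) sequentially"
    using a evpos by (auto simp: filterlim_at elim: eventually_mono)
  then have speed: "filterlim (\<lambda>n. 1 / a n) at_top sequentially"
    using filterlim_compose[OF filterlim_inverse_at_top_right] by (simp add: inverse_eq_divide)
  have rate: "rate_function ?I"
    using \<open>p > 0\<close> \<open>q > 0\<close> by (intro rate_function_two_slopes) auto
  have upper: "limsup (\<lambda>n. ereal (a n) * log_prob \<P>(\<omega> in M. Y n \<omega> \<in> C)) \<le> - (INF x\<in>C. ?I x)"
    (is "?L \<le> - ?m") for C
  proof (cases "0 < ?m")
    case True
    have "?m \<le> - ?L"
    \<comment> \<open>Every \<open>w\<close> strictly between 0 and \<open>?m\<close> is finite,
      even when \<open>?m\<close> is infinite, as for empty \<open>C\<close>.\<close>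
    proof (rule dense_le_bounded[OF True])
      fix w assume w: "0 < w" "w < ?m"
      then obtain c where c: "w = ereal c" "c > 0"
        by (cases w) auto
      \<comment> \<open>The cutoffs \<open>- (c / p)\<close> and \<open>c / q\<close> are the two
        points where the rate equals \<open>c\<close>, so both tails have the same exponent
        \<open>- c\<close>.\<close>
      have cover: "x \<le> - (c / p) \<or> c / q < x" if "x \<in> C" for x
      proof -
        have "ereal c < ?I x"
          using w c that by (meson INF_lower less_le_trans)
        then show ?thesis
          using \<open>p > 0\<close> \<open>q > 0\<close> by (auto simp: field_simps split: if_splits)
      qed
      have "\<forall>\<^sub>F n in sequentially. 0 \<le> \<P>(\<omega> in M. Y n \<omega> \<in> C) \<and>
          \<P>(\<omega> in M. Y n \<omega> \<in> C) \<le> \<P>(\<omega> in M. Y n \<omega> \<le> - (c / p)) + \<P>(\<omega> in M. c / q < Y n \<omega>)"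
        using ge1
      proof eventually_elim
        case (elim n)
        note [measurable] = meas[OF elim]
        have "\<P>(\<omega> in M. Y n \<omega> \<in> C) \<le>
            prob ({\<omega> \<in> space M. Y n \<omega> \<le> - (c / p)} \<union> {\<omega> \<in> space M. c / q < Y n \<omega>})"
          using cover by (intro finite_measure_mono) auto
        also have "\<dots> \<le> \<P>(\<omega> in M. Y n \<omega> \<le> - (c / p)) + \<P>(\<omega> in M. c / q < Y n \<omega>)"
          by (intro measure_Un_le) measurable
        finally show ?case by simp
      qed
      moreover have "(\<lambda>n. a n * ln \<P>(\<omega> in M. Y n \<omega> \<le> - (c / p))) \<longlonglongrightarrow> - c"
        using left(2)[of "c / p"] c \<open>p > 0\<close> by simp
      moreover have "(\<lambda>n. a n * ln \<P>(\<omega> in M. c / q < Y n \<omega>)) \<longlonglongrightarrow> - c"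
        using right(2)[of "c / q"] c \<open>q > 0\<close> by simp
      ultimately have "?L \<le> ereal (- c)"
        using c \<open>p > 0\<close> \<open>q > 0\<close>
        by (intro limsup_log_prob_le[OF evpos a left(1) _ right(1)]) auto
      then show "w \<le> - ?L"
        using c ereal_minus_le_minus[of "ereal (- c)" ?L] by simp
    qed
    then have "- (- ?L) \<le> - ?m"
      by (simp only: ereal_minus_le_minus)
    then show ?thesis
      by (simp only: ereal_uminus_uminus)
  next
    case False
    \<comment> \<open>The infimum is at most 0, so the bound reduces to probabilities being at most
      1.\<close>
    have "\<forall>\<^sub>F n in sequentially. ereal (a n) * log_prob \<P>(\<omega> in M. Y n \<omega> \<in> C) \<le> 0"
      using evpos
    proof eventually_elim
      case (elim n)
      have "ln \<P>(\<omega> in M. Y n \<omega> \<in> C) \<le> 0" if "\<P>(\<omega> in M. Y n \<omega> \<in> C) \<noteq> 0"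
        using that by (simp add: zero_less_measure_iff)
      then show ?case
        using elim by (auto simp: log_prob_def mult_le_0_iff)
    qed
    then have "?L \<le> 0"
      by (intro Limsup_bounded)
    also have "0 \<le> - ?m"
      using False by simp
    finally show ?thesis .
  qed
  have lower: "- (INF x\<in>U. ?I x) \<le> liminf (\<lambda>n. ereal (a n) * log_prob \<P>(\<omega> in M. Y n \<omega> \<in> U))"
    (is "- ?m \<le> ?L") if "open U" for U
  proof -
    have U: "{\<omega> \<in> space M. Y n \<omega> \<in> U} \<in> events" if "n \<ge> 1" for n
      using measurable_sets[OF meas[OF that] borel_open[OF \<open>open U\<close>]]
      by (simp add: vimage_def Int_def conj_commute)
    \<comment> \<open>A local bound at each point of \<open>U\<close> suffices: it makes
      \<open>- ?L\<close> a lower bound of the rate on \<open>U\<close>, hence at most the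
      infimum.\<close>
    have "- ?L \<le> ?I x" if "x \<in> U" for x
    proof -
      obtain d where d: "d > 0" "{x - d..x + d} \<subseteq> U"
        using \<open>open U\<close> \<open>x \<in> U\<close> by (metis open_contains_cball cball_eq_atLeastAtMost)
      show ?thesis
      proof (cases "x \<le> 0")
        case True
        \<comment> \<open>The interval from \<open>x - d\<close> (excluded) to \<open>x\<close> lies
          in \<open>U\<close>. Its endpoints are written as \<open>- (- x)\<close> and
          \<open>- (d - x)\<close> to match \<open>left\<close> at the nonnegative arguments
          \<open>- x\<close> and \<open>d - x\<close>; the exponents are \<open>p * x\<close> and
          \<open>p * x - p * d\<close>, so the nearer tail dominates.\<close>
        have P: "\<forall>\<^sub>F n in sequentially.
            \<P>(\<omega> in M. Y n \<omega> \<le> - (- x)) - \<P>(\<omega> in M. Y n \<omega> \<le> - (d - x)) \<le> \<P>(\<omega> in M. Y n \<omega> \<in> U)"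
          using ge1
        proof eventually_elim
          case (elim n)
          note [measurable] = meas[OF elim]
          have "\<P>(\<omega> in M. Y n \<omega> \<le> x) - \<P>(\<omega> in M. Y n \<omega> \<le> x - d)
              = prob ({\<omega> \<in> space M. Y n \<omega> \<le> x} - {\<omega> \<in> space M. Y n \<omega> \<le> x - d})"
            using d by (intro finite_measure_Diff[symmetric]) auto
          also have "\<dots> \<le> \<P>(\<omega> in M. Y n \<omega> \<in> U)"
            using d U[OF elim] by (intro finite_measure_mono) (auto intro!: subsetD[OF d(2)])
          finally show ?case by simp
        qed
        have "ereal (- p * (- x)) \<le> ?L"
          using True d \<open>p > 0\<close>
          by (intro liminf_log_prob_ge[OF evpos a left(1) left(2) left(1) left(2) _ P])
            (auto simp: right_diff_distrib)
        then show ?thesis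
          using True by (simp add: ereal_uminus_le_reorder)
      next
        case False
        \<comment> \<open>Mirror image: the interval from \<open>x\<close> (excluded) to
          \<open>x + d\<close> again extends away from the origin, so the tail beyond
          \<open>x\<close> dominates.\<close>
        have P: "\<forall>\<^sub>F n in sequentially.
            \<P>(\<omega> in M. x < Y n \<omega>) - \<P>(\<omega> in M. x + d < Y n \<omega>) \<le> \<P>(\<omega> in M. Y n \<omega> \<in> U)"
          using ge1
        proof eventually_elim
          case (elim n)
          note [measurable] = meas[OF elim]
          have "\<P>(\<omega> in M. x < Y n \<omega>) - \<P>(\<omega> in M. x + d < Y n \<omega>)
              = prob ({\<omega> \<in> space M. x < Y n \<omega>} - {\<omega> \<in> space M. x + d < Y n \<omega>})"
            using d by (intro finite_measure_Diff[symmetric]) auto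
          also have "\<dots> \<le> \<P>(\<omega> in M. Y n \<omega> \<in> U)"
            using d U[OF elim] by (intro finite_measure_mono) (auto intro!: subsetD[OF d(2)])
          finally show ?case .
        qed
        have "ereal (- q * x) \<le> ?L"
          using False d \<open>q > 0\<close>
          by (intro liminf_log_prob_ge[OF evpos a right(1) right(2) right(1) right(2) _ P]) auto
        then show ?thesis
          using False by (simp add: ereal_uminus_le_reorder)
      qed
    qed
    then have "- ?L \<le> ?m"
      by (rule INF_greatest)
    then show ?thesis
      by (simp only: ereal_uminus_le_reorder[of ?m])
  qed
  show ?thesis
    unfolding satisfies_LDP_def using meas speed rate upper lower by simp
qed

section \<open>The two tails of \<open>Z n\<close> around \<open>t\<close>\<close>

theorem proposition6p2:
  fixes F G :: "real \<Rightarrow> real" and t F't G't \<beta> :: real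
    and M :: "'a measure" and Z :: "nat \<Rightarrow> 'a \<Rightarrow> real" and a :: "nat \<Rightarrow> real"
  assumes "distribution_function F" and "continuous_on UNIV F"
    and "distribution_function G" and "continuous_on UNIV G"
    and "F 0 = 0" and "G 0 = 0"
    and "strict_mono_on {0..} F" and "strict_mono_on {0..} G"
    and "t > 0"
    and "(F has_real_derivative F't) (at_left t)" and "F't > 0"
    and "(G has_real_derivative G't) (at_right t)" and "G't > 0"
    and "0 < \<beta>" and "\<beta> < 1"
    and "prob_space M"
    and "\<And>n. n \<ge> 1 \<Longrightarrow> Z n \<in> borel_measurable M"
    and "\<And>n x. n \<ge> 1 \<Longrightarrow> x \<in> {0..t} \<Longrightarrow>
           \<P>(\<omega> in M. Z n \<omega> \<le> x) = \<beta> * (F x / F t) ^ n"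
    and "\<And>n x. n \<ge> 1 \<Longrightarrow> x \<in> {t<..} \<Longrightarrow>
           \<P>(\<omega> in M. Z n \<omega> \<le> x) = 1 - (1 - \<beta>) * ((1 - G x) / (1 - G t)) ^ n"
    and "\<And>n. n \<ge> 1 \<Longrightarrow> a n > 0"
    and "(\<lambda>n. a n * ln (real n)) \<longlonglongrightarrow> 0"
    and "filterlim (\<lambda>n. a n * real n) at_top sequentially"
  shows "satisfies_LDP M (\<lambda>n \<omega>. a n * real n * (Z n \<omega> - t)) (\<lambda>n. 1 / a n)
           (\<lambda>x. if x \<le> 0 then ereal (- (F't / F t) * x) else ereal (G't / (1 - G t) * x))"
proof -
  interpret prob_space M by fact
  let ?r = "\<lambda>n. a n * real n"
  have r: "filterlim ?r at_top sequentially" by fact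
  have rpos: "\<forall>\<^sub>F n in sequentially. ?r n > 0"
    using r by (simp add: filterlim_at_top_dense)
  have ge1: "\<forall>\<^sub>F n :: nat in sequentially. n \<ge> 1"
    by (rule eventually_ge_at_top)
  have a0: "a \<longlonglongrightarrow> 0"
  \<comment> \<open>From \<open>n = 3\<close> on, \<open>ln n\<close> is at least 1 because
    \<open>exp 1 \<le> 3\<close>, so \<open>a n\<close> lies between 0 and
    \<open>a n * ln n\<close>.\<close>
  proof (rule tendsto_sandwich[OF _ _ tendsto_const assms(21)])
    show "\<forall>\<^sub>F n in sequentially. 0 \<le> a n"
      using ge1 by eventually_elim (use assms(20) in \<open>simp add: less_imp_le\<close>)
    show "\<forall>\<^sub>F n in sequentially. a n \<le> a n * ln (real n)"
      using eventually_ge_at_top[of 3]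
    proof eventually_elim
      case (elim n)
      have "exp 1 \<le> real n"
        using exp_le elim by linarith
      then have "1 \<le> ln (real n)"
        using elim by (subst ln_ge_iff) auto
      then show ?case
        using assms(20)[of n] elim by simp
    qed
  qed
  have Fpos: "F y > 0" if "y > 0" for y
    using strict_mono_onD[OF \<open>strict_mono_on {0..} F\<close>, of 0 y] that \<open>F 0 = 0\<close> by simp
  have G1: "G y \<le> 1" for y
  proof -
    obtain \<mu> where \<mu>: "real_distribution \<mu>" "G = cdf \<mu>"
      using \<open>distribution_function G\<close> unfolding distribution_function_def by blast
    interpret \<mu>: real_distribution \<mu> by fact
    show ?thesis
      by (simp add: \<mu>(2) \<mu>.cdf_bounded_prob)
  qed
  \<comment> \<open>Strict monotonicity leaves room below 1:
    \<open>G y < G (y + 1) \<le> 1\<close>.\<close>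
  have Gpos: "1 - G y > 0" if "y \<ge> 0" for y
    using strict_mono_onD[OF \<open>strict_mono_on {0..} G\<close>, of y "y + 1"] that G1[of "y + 1"] by simp
  have shift_le: "a n * real n * (Z n \<omega> - t) \<le> x \<longleftrightarrow> Z n \<omega> \<le> t + x / ?r n"
    if "?r n > 0" for n x \<omega>
    using pos_le_divide_eq[OF that, of "Z n \<omega> - t" x] by (simp add: mult.commute diff_le_eq add.commute)
  have shift_lt: "x < a n * real n * (Z n \<omega> - t) \<longleftrightarrow> t + x / ?r n < Z n \<omega>"
    if "?r n > 0" for n x \<omega>
    using shift_le[OF that, of \<omega> x] by linarith

  have left: "\<forall>\<^sub>F n in sequentially. \<P>(\<omega> in M. a n * real n * (Z n \<omega> - t) \<le> - x) > 0"
      "(\<lambda>n. a n * ln \<P>(\<omega> in M. a n * real n * (Z n \<omega> - t) \<le> - x)) \<longlonglongrightarrow> - (F't / F t) * x"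
    if "x \<ge> 0" for x
  proof -
    \<comment> \<open>The power formula for \<open>F\<close> is given only on \<open>{0..t}\<close>,
      so the evaluation point must eventually be positive.\<close>
    have "(\<lambda>n. - x / ?r n) \<longlonglongrightarrow> 0"
      by (intro real_tendsto_divide_at_top[OF tendsto_const] r)
    then have "\<forall>\<^sub>F n in sequentially. - t < - x / ?r n"
      using \<open>t > 0\<close> by (intro order_tendstoD(1)) auto
    then have near: "\<forall>\<^sub>F n in sequentially. 0 < t + - x / ?r n"
      by eventually_elim simp
    have S: "\<forall>\<^sub>F n in sequentially. t + - x / ?r n \<in> insert t {0<..<t}"
      using near rpos by eventually_elim (use \<open>x \<ge> 0\<close> in auto)
    have pos: "\<forall>y\<in>insert t {0<..<t}. F y > 0"
      using Fpos \<open>t > 0\<close> by auto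
    \<comment> \<open>Restricting the left derivative to \<open>{0<..<t}\<close> makes
      \<open>F\<close> positive on the whole approach set, as the logarithm requires.\<close>
    have "(F has_real_derivative F't) (at t within {0<..<t})"
      using assms(10) by (rule DERIV_subset) auto
    note lim = scaled_ln_power_tendsto[OF this pos \<open>0 < \<beta>\<close> a0 r S]
    have eq: "\<forall>\<^sub>F n in sequentially. \<beta> * (F (t + - x / ?r n) / F t) ^ n
        = \<P>(\<omega> in M. a n * real n * (Z n \<omega> - t) \<le> - x)"
      using near rpos ge1
    proof eventually_elim
      case (elim n)
      have "t + - x / ?r n \<in> {0..t}"
        using elim \<open>x \<ge> 0\<close> by auto
      from assms(18)[OF _ this] elim show ?case
        by (simp only: shift_le)
    qed
    show "\<forall>\<^sub>F n in sequentially. \<P>(\<omega> in M. a n * real n * (Z n \<omega> - t) \<le> - x) > 0"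
      using lim(1) eq by eventually_elim simp
    have "(\<lambda>n. a n * ln (\<beta> * (F (t + - x / ?r n) / F t) ^ n)) \<longlonglongrightarrow> - (F't / F t) * x"
      using lim(2) by simp
    moreover have "\<forall>\<^sub>F n in sequentially. a n * ln (\<beta> * (F (t + - x / ?r n) / F t) ^ n)
        = a n * ln \<P>(\<omega> in M. a n * real n * (Z n \<omega> - t) \<le> - x)"
      using eq by eventually_elim simp
    ultimately show "(\<lambda>n. a n * ln \<P>(\<omega> in M. a n * real n * (Z n \<omega> - t) \<le> - x))
        \<longlonglongrightarrow> - (F't / F t) * x"
      by (rule Lim_transform_eventually)
  qed

  have right: "\<forall>\<^sub>F n in sequentially. \<P>(\<omega> in M. x < a n * real n * (Z n \<omega> - t)) > 0"
      "(\<lambda>n. a n * ln \<P>(\<omega> in M. x < a n * real n * (Z n \<omega> - t))) \<longlonglongrightarrow> - (G't / (1 - G t)) * x"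
    if "x \<ge> 0" for x
  proof -
    have S: "\<forall>\<^sub>F n in sequentially. t + x / ?r n \<in> insert t {t<..}"
      using rpos by eventually_elim (use \<open>x \<ge> 0\<close> in auto)
    have pos: "\<forall>y\<in>insert t {t<..}. 1 - G y > 0" "1 - \<beta> > 0"
      using Gpos \<open>t > 0\<close> \<open>\<beta> < 1\<close> by auto
    have "((\<lambda>y. 1 - G y) has_real_derivative - G't) (at_right t)"
      using assms(12) by (auto intro!: derivative_eq_intros)
    note lim = scaled_ln_power_tendsto[OF this pos a0 r S]
    have upper_tail: "\<P>(\<omega> in M. y < Z n \<omega>) = (1 - \<beta>) * ((1 - G y) / (1 - G t)) ^ n"
      if "n \<ge> 1" "y \<ge> t" for n y
    proof -
      note [measurable] = assms(17)[OF \<open>n \<ge> 1\<close>]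
      have "\<P>(\<omega> in M. y < Z n \<omega>) = 1 - \<P>(\<omega> in M. Z n \<omega> \<le> y)"
        by (subst prob_neg[symmetric]) (auto simp: not_le)
      moreover have "\<P>(\<omega> in M. Z n \<omega> \<le> y) = 1 - (1 - \<beta>) * ((1 - G y) / (1 - G t)) ^ n"
      \<comment> \<open>The formula with \<open>G\<close> is given only beyond \<open>t\<close>. At
        \<open>t\<close> the formula with \<open>F\<close> yields \<beta>, which equals 1 - (1 -
        \<beta>), so the two agree there; this endpoint is what \<open>x = 0\<close> needs.\<close>
      proof (cases "y = t")
        case True
        then show ?thesis
          using assms(18)[of n t] that \<open>t > 0\<close> Fpos[of t] Gpos[of t] by simp
      next
        case False
        then show ?thesis
          using assms(19)[of n y] that by simp
      qed
      ultimately show ?thesis by simp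
    qed
    have eq: "\<forall>\<^sub>F n in sequentially. (1 - \<beta>) * ((1 - G (t + x / ?r n)) / (1 - G t)) ^ n
        = \<P>(\<omega> in M. x < a n * real n * (Z n \<omega> - t))"
      using rpos ge1
    proof eventually_elim
      case (elim n)
      have "t + x / ?r n \<ge> t"
        using elim \<open>x \<ge> 0\<close> by simp
      from upper_tail[OF _ this] elim show ?case
        by (simp only: shift_lt)
    qed
    show "\<forall>\<^sub>F n in sequentially. \<P>(\<omega> in M. x < a n * real n * (Z n \<omega> - t)) > 0"
      using lim(1) eq by eventually_elim simp
    have "(\<lambda>n. a n * ln ((1 - \<beta>) * ((1 - G (t + x / ?r n)) / (1 - G t)) ^ n))
        \<longlonglongrightarrow> - (G't / (1 - G t)) * x"
      using lim(2) by simp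
    moreover have "\<forall>\<^sub>F n in sequentially.
        a n * ln ((1 - \<beta>) * ((1 - G (t + x / ?r n)) / (1 - G t)) ^ n)
        = a n * ln \<P>(\<omega> in M. x < a n * real n * (Z n \<omega> - t))"
      using eq by eventually_elim simp
    ultimately show "(\<lambda>n. a n * ln \<P>(\<omega> in M. x < a n * real n * (Z n \<omega> - t)))
        \<longlonglongrightarrow> - (G't / (1 - G t)) * x"
      by (rule Lim_transform_eventually)
  qed

  show ?thesis
  proof (rule satisfies_LDP_if_tail_limits)
    show "(\<lambda>\<omega>. a n * real n * (Z n \<omega> - t)) \<in> borel_measurable M" if "n \<ge> 1" for n
      using assms(17)[OF that] by measurable
  qed (use assms(16,20) a0 left right Fpos[of t] Gpos[of t] \<open>t > 0\<close> \<open>F't > 0\<close> \<open>G't > 0\<close> in auto)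
qed

end
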